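(* Let $N = q^k n^2$ be an odd perfect number given in Eulerian form. Define $H = \gcd(n^2,\sigma(n^2))$, $I = \gcd(n,\sigma(n^2))$ and $J = H/I$. If $\sigma(q^k)/2$ is squarefree, then $J \neq 1$.
   Context: $\sigma(x)$ denotes the sum of the positive divisors of $x$. A positive integer $N$ is perfect if $\sigma(N)=2N$. An odd perfect number $N$ is said to be given in Eulerian form $N = q^k n^2$ if $q$ is a prime (the special prime), $k$ and $n$ are positive integers, $q \equiv k \equiv 1 \pmod 4$, and $\gcd(q,n)=1$. *)

theory Defs
  imports "HOL-Number_Theory.Number_Theory" "HOL-Computational_Algebra.Squarefree"
begin

definition sigma :: "nat \<Rightarrow> nat" where
  "sigma x = \<Sum> {d. d dvd x}"

definition perfect :: "nat \<Rightarrow> bool" where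
  "perfect N \<longleftrightarrow> N > 0 \<and> sigma N = 2 * N"

definition eulerian_form :: "nat \<Rightarrow> nat \<Rightarrow> nat \<Rightarrow> nat \<Rightarrow> bool" where
  "eulerian_form N q k n \<longleftrightarrow>
     N = q ^ k * n\<^sup>2 \<and> prime q \<and> k > 0 \<and> n > 0 \<and>
     [q = 1] (mod 4) \<and> [k = 1] (mod 4) \<and> coprime q n"

text \<open>Both quotients used with this notion, \<open>sigma (q ^ k) div 2\<close> and
  \<open>gcd (n\<^sup>2) (sigma (n\<^sup>2)) div gcd n (sigma (n\<^sup>2))\<close>, are exact, so
  truncating division agrees with ordinary division.\<close>

lemma eulerian_form_even_sigma:
  assumes "eulerian_form N q k n"
  shows "even (sigma (q ^ k))"
proof -
  have q: "prime q" and qm: "q mod 4 = 1" and km: "k mod 4 = 1"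
    using assms by (auto simp: eulerian_form_def cong_def)
  have oq: "odd q" using qm by presburger
  have ok: "odd k" using km by presburger
  have q1: "q > 1" using q by (rule prime_gt_1_nat)
  have "{d. d dvd q ^ k} = (\<lambda>i. q ^ i) ` {..k}"
    using q by (auto simp: divides_primepow_nat)
  moreover have "inj_on (\<lambda>i. q ^ i) {..k}"
    using q1 by (auto intro: inj_onI)
  ultimately have "sigma (q ^ k) = (\<Sum>i\<le>k. q ^ i)"
    by (simp add: sigma_def sum.reindex)
  moreover have "even (\<Sum>i\<le>m. q ^ i) \<longleftrightarrow> odd m" for m
    by (induction m) (use oq in auto)
  ultimately show ?thesis using ok by simp
qed

lemma gcd_dvd_gcd_square: "gcd n (sigma (n\<^sup>2)) dvd gcd (n\<^sup>2) (sigma (n\<^sup>2))"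
  by (simp add: power2_eq_square)

end

theory Submission
  imports Defs
begin

text \<open>If \<open>J = 1\<close>, then \<open>H = \<sigma>(n\<^sup>2) / q\<^sup>k\<close> divides \<open>n\<close>, and squarefreeness of
  \<open>\<sigma>(q\<^sup>k) / 2 = n\<^sup>2 / H\<close> forces \<open>n = H = \<sigma>(q\<^sup>k) / 2\<close>. So \<open>n\<close> is squarefree with
  \<open>\<sigma>(n\<^sup>2) = q\<^sup>k n\<close>, which leads to Steuerwald's argument: every prime factor of \<open>\<sigma>(n\<^sup>2)\<close>, hence
  of \<open>n\<close>, divides some \<open>p\<^sup>2 + p + 1\<close> and so is \<open>3\<close> or congruent to \<open>1\<close> modulo \<open>3\<close>; each prime factor
  of \<open>n\<close> of the latter kind contributes a factor \<open>3\<close> to \<open>\<sigma>(n\<^sup>2)\<close>, while \<open>9\<close> does not divide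
  \<open>q\<^sup>k n\<close>. Hence \<open>n = 3p\<close>, and \<open>13 (p\<^sup>2 + p + 1) = 3 q\<^sup>k p\<close> leaves only \<open>p = 13\<close>,
  \<open>q\<^sup>k = 61\<close>, where \<open>\<sigma>(q\<^sup>k) / 2 = 31 \<noteq> 39 = n\<close>.\<close>

section \<open>Multiplicativity of \<open>sigma\<close> and its values at prime powers\<close>

lemma sigma_mult_coprime:
  assumes "coprime a b"
  shows "sigma (a * b) = sigma a * sigma b"
proof (cases "a = 0 \<or> b = 0")
  case True
  \<comment> \<open>Every number divides \<open>0\<close>, and the sum over this infinite set is
    \<open>0\<close> by convention, so \<open>sigma 0 = 0\<close>.\<close>
  then show ?thesis by (auto simp: sigma_def)
next
  case False
  have inj: "inj_on (\<lambda>(x, y). x * y) ({d. d dvd a} \<times> {d. d dvd b})"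
  proof (rule inj_onI, clarsimp)
    fix x y x' y'
    assume d: "x dvd a" "y dvd b" "x' dvd a" "y' dvd b" and eq: "x * y = x' * y'"
    have c: "coprime x y'" "coprime x' y"
      using d assms by (meson coprime_divisors)+
    have "x dvd x'" using c(1) eq by (metis coprime_dvd_mult_left_iff dvd_triv_left)
    moreover have "x' dvd x" using c(2) eq by (metis coprime_dvd_mult_left_iff dvd_triv_left)
    ultimately have "x = x'" by (rule dvd_antisym)
    moreover have "x > 0" using d(1) False by (auto intro: Nat.gr0I)
    ultimately show "x = x' \<and> y = y'" using eq by simp
  qed
  have img: "{d. d dvd a * b} = (\<lambda>(x, y). x * y) ` ({d. d dvd a} \<times> {d. d dvd b})"
  proof (rule Set.set_eqI)
    fix d
    have "d \<in> (\<lambda>(x, y). x * y) ` ({d. d dvd a} \<times> {d. d dvd b}) \<longleftrightarrow>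
        (\<exists>x y. d = x * y \<and> x dvd a \<and> y dvd b)"
      by auto
    also have "\<dots> \<longleftrightarrow> d dvd a * b"
      by (auto simp: mult_dvd_mono dest: division_decomp)
    finally show "d \<in> {d. d dvd a * b} \<longleftrightarrow> d \<in> (\<lambda>(x, y). x * y) ` ({d. d dvd a} \<times> {d. d dvd b})"
      by simp
  qed
  show ?thesis
    unfolding sigma_def img
    by (subst sum.reindex[OF inj]) (simp add: sum_product sum.cartesian_product comp_def case_prod_unfold)
qed

lemma sigma_prime_power:
  assumes "prime p"
  shows "sigma (p ^ k) = (\<Sum>i\<le>k. p ^ i)"
proof -
  have "{d. d dvd p ^ k} = (\<lambda>i. p ^ i) ` {..k}"
    using assms by (auto simp: divides_primepow_nat)
  moreover have "inj_on (\<lambda>i. p ^ i) {..k}"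
    using prime_gt_1_nat[OF assms] by (auto intro: inj_onI)
  ultimately show ?thesis
    by (simp add: sigma_def sum.reindex)
qed

text \<open>Modulo \<open>p\<close> only the term \<open>p ^ 0\<close> of the divisor sum
  survives.\<close>

lemma coprime_sigma_prime_power:
  assumes "prime p"
  shows "coprime p (sigma (p ^ k))"
proof -
  have "sigma (p ^ k) = 1 + p * (\<Sum>i<k. p ^ i)"
    by (simp only: sigma_prime_power[OF assms] sum.atMost_shift sum_distrib_left) simp
  then show ?thesis by (auto intro: coprime_divisors[OF _ dvd_refl coprime_Suc_right_nat])
qed

lemma sigma_1 [simp]: "sigma (Suc 0) = 1"
  by (simp add: sigma_def)

lemma sigma_square_prime_mult:
  assumes "prime p" "coprime p m"
  shows "sigma ((p * m)\<^sup>2) = (1 + p + p\<^sup>2) * sigma (m\<^sup>2)"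
proof -
  have "sigma (p\<^sup>2) = 1 + p + p\<^sup>2"
    by (simp only: sigma_prime_power[OF assms(1)]) (simp add: numeral_2_eq_2)
  then show ?thesis
    using assms(2) by (simp add: power_mult_distrib sigma_mult_coprime)
qed

section \<open>Prime factors of \<open>sigma (n\<^sup>2)\<close> for squarefree
  \<open>n\<close>\<close>

lemma squarefree_prime_dvdE:
  fixes n p :: nat
  assumes "squarefree n" "prime p" "p dvd n"
  obtains m where "n = p * m" "coprime p m" "squarefree m"
proof -
  from \<open>p dvd n\<close> obtain m where m: "n = p * m" ..
  have "\<not> p dvd m"
  proof
    assume "p dvd m"
    then have "p\<^sup>2 dvd n" by (simp add: m power2_eq_square mult_dvd_mono)
    then have "p dvd 1" using assms(1) by (auto simp: squarefree_def)
    then show False using assms(2) by simp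
  qed
  then have "coprime p m" using assms(2) by (simp add: prime_imp_coprime)
  moreover have "squarefree m"
    by (rule squarefree_mono[OF _ assms(1)]) (simp add: m)
  ultimately show thesis using that m by blast
qed

text \<open>Modulo \<open>r\<close> the order of \<open>x\<close> divides 3; if
  \<open>r mod 3 = 2\<close>, it also divides \<open>r - 1\<close>, which is coprime to 3, so
  \<open>x\<close> is 1 modulo \<open>r\<close> and \<open>r\<close> divides 3.\<close>

lemma prime_dvd_cyclotomic3:
  fixes r x :: nat
  assumes "prime r" "r dvd 1 + x + x\<^sup>2"
  shows "r mod 3 \<noteq> 2"
proof
  assume r2: "r mod 3 = 2"
  define t where "t = r div 3"
  have t: "r = 3 * t + 2" using r2 unfolding t_def by presburger
  have nd: "\<not> r dvd x"
  proof
    assume "r dvd x"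
    then have "r dvd x + x\<^sup>2" by (simp add: power2_eq_square)
    then have "r dvd 1" using assms(2) by (metis add.assoc dvd_add_left_iff)
    then show False using assms(1) by simp
  qed
  have "[x ^ 3 = 1] (mod r)"
  proof -
    have "int x ^ 3 - 1 = (int x - 1) * int (1 + x + x\<^sup>2)"
      by (simp add: algebra_simps power2_eq_square power3_eq_cube)
    then have "int r dvd int x ^ 3 - 1"
      using assms(2) by (metis dvd_mult of_nat_dvd_iff)
    then have "[int (x ^ 3) = int 1] (mod int r)"
      by (simp add: cong_iff_dvd_diff)
    then show ?thesis by (simp only: cong_int_iff)
  qed
  \<comment> \<open>Here \<open>r - 1 = 3 * t + 1\<close>, so the left side is the Fermat power
    \<open>x ^ (r - 1)\<close>.\<close>
  then have "[(x ^ 3) ^ t * x = 1 ^ t * x] (mod r)"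
    by (intro cong_mult cong_pow) auto
  moreover have "(x ^ 3) ^ t * x = x ^ (r - 1)"
    by (simp add: t power_mult)
  moreover have "[x ^ (r - 1) = 1] (mod r)"
    using assms(1) nd by (rule fermat_theorem)
  ultimately have x1: "[x = 1] (mod r)"
    by (metis cong_sym cong_trans mult_1 power_one)
  then have "[1 + x + x\<^sup>2 = 1 + 1 + 1\<^sup>2] (mod r)"
    by (intro cong_add cong_pow) auto
  then have "r dvd 3"
    using assms(2) cong_dvd_iff by (fastforce simp: numeral_3_eq_3)
  then have "r = 3" using assms(1) by (simp add: primes_dvd_imp_eq)
  then show False using r2 by simp
qed

text \<open>Splitting off one prime \<open>p\<close> at a time writes
  \<open>sigma (n\<^sup>2)\<close> as a product of factors \<open>1 + p + p\<^sup>2\<close>, and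
  \<open>r\<close> divides one of them.\<close>

lemma prime_dvd_sigma_square:
  fixes n r :: nat
  assumes "squarefree n" "prime r" "r dvd sigma (n\<^sup>2)"
  shows "r mod 3 \<noteq> 2"
  using assms(1,3)
proof (induction n rule: less_induct)
  case (less n)
  show ?case
  proof (cases "n = 1")
    case True
    then show ?thesis using less.prems assms(2) by simp
  next
    case False
    then obtain p where p: "prime p" "p dvd n" using prime_factor_nat by blast
    obtain m where m: "n = p * m" "coprime p m" "squarefree m"
      by (rule squarefree_prime_dvdE[OF less.prems(1) p])
    have "r dvd (1 + p + p\<^sup>2) * sigma (m\<^sup>2)"
      using less.prems(2) m p by (simp add: sigma_square_prime_mult)
    then consider "r dvd 1 + p + p\<^sup>2" | "r dvd sigma (m\<^sup>2)"
      using assms(2) prime_dvd_mult_iff by blast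
    then show ?thesis
    proof cases
      case 1
      then show ?thesis using assms(2) prime_dvd_cyclotomic3 by blast
    next
      case 2
      have "m > 0" using m(3) by (auto intro: Nat.gr0I)
      then have "m < n" using m(1) prime_gt_1_nat[OF p(1)] by simp
      then show ?thesis using less.IH m(3) 2 by blast
    qed
  qed
qed

section \<open>The equation \<open>sigma (n\<^sup>2) = q ^ k * n\<close> for squarefree
  \<open>n\<close>\<close>

lemma three_dvd_cyclotomic3:
  fixes p :: nat
  assumes "p mod 3 = 1"
  shows "3 dvd 1 + p + p\<^sup>2"
proof -
  have "[1 + p + p\<^sup>2 = 1 + 1 + 1\<^sup>2] (mod 3)"
    using assms by (intro cong_add cong_pow) (auto simp: cong_def)
  moreover have "3 dvd 1 + 1 + (1::nat)\<^sup>2" by (simp add: numeral_3_eq_3)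
  ultimately show ?thesis using cong_dvd_iff by blast
qed

lemma sigma_square_eq_prime_power_mult:
  fixes n q k :: nat
  assumes sf: "squarefree n" and q: "prime q" "q mod 4 = 1" and "k > 0"
    and eq: "sigma (n\<^sup>2) = q ^ k * n"
  shows "n = 39 \<and> q ^ k = 61"
proof -
  have residue: "p = 3 \<or> p mod 3 = 1" if "prime p" "p dvd n" for p
  proof -
    have "p dvd sigma (n\<^sup>2)" using that eq by simp
    then have "p mod 3 \<noteq> 2" using prime_dvd_sigma_square sf that by blast
    moreover have "p = 3" if "p mod 3 = 0"
    proof -
      have "3 dvd p" using that by (rule mod_0_imp_dvd)
      then show ?thesis using \<open>prime p\<close> primes_dvd_imp_eq[of 3 p] by simp
    qed
    ultimately show ?thesis by (cases "p mod 3 = 0") auto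
  qed
  have q3: "\<not> 3 dvd q ^ k"
  proof
    assume "3 dvd q ^ k"
    then have "3 dvd q" by (rule prime_dvd_power[rotated]) simp
    then have "3 = q" using q(1) by (simp add: primes_dvd_imp_eq)
    then show False using q(2) by simp
  qed
  have "n \<noteq> 1"
    using eq q(1) \<open>k > 0\<close> by (metis mult_1_right nat_neq_iff one_power2 prime_power_eq_one_iff sigma_1 One_nat_def)
  then obtain p0 where p0: "prime p0" "p0 dvd n" using prime_factor_nat by blast
  \<comment> \<open>A prime factor other than 3 is 1 modulo 3, so it puts a 3 into
    \<open>q ^ k * n\<close>, which \<open>q ^ k\<close> cannot absorb.\<close>
  have "3 dvd n"
  proof (cases "p0 = 3")
    case False
    then have "3 dvd 1 + p0 + p0\<^sup>2" using residue p0 three_dvd_cyclotomic3 by blast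
    moreover obtain m where "n = p0 * m" "coprime p0 m"
      by (rule squarefree_prime_dvdE[OF sf p0])
    ultimately have "3 dvd sigma (n\<^sup>2)"
      by (simp only: sigma_square_prime_mult[OF p0(1)] dvd_mult2)
    then show ?thesis
      using eq q3 prime_dvd_mult_iff[of "3::nat"] by simp
  qed (use p0 in simp)
  obtain m where m: "n = 3 * m" "coprime 3 m" "squarefree m"
    by (rule squarefree_prime_dvdE[OF sf _ \<open>3 dvd n\<close>]) simp_all
  \<comment> \<open>The factor 13 is \<open>1 + 3 + 3\<^sup>2\<close>, split off with the prime
    3.\<close>
  have eq3: "13 * sigma (m\<^sup>2) = q ^ k * (3 * m)"
    using eq m sigma_square_prime_mult[of 3 m] by simp
  have residue_m: "p mod 3 = 1" if "prime p" "p dvd m" for p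
    using residue[of p] that m by auto
  have "m \<noteq> 1"
  proof
    assume "m = 1"
    then have "13 = q ^ k * 3" using eq3 by simp
    then show False by presburger
  qed
  then obtain p where p: "prime p" "p dvd m" using prime_factor_nat by blast
  obtain l where l: "m = p * l" "coprime p l" "squarefree l"
    by (rule squarefree_prime_dvdE[OF m(3) p])
  have eqp: "13 * ((1 + p + p\<^sup>2) * sigma (l\<^sup>2)) = 3 * (q ^ k * m)"
    using eq3 l p sigma_square_prime_mult[of p l] by simp
  \<comment> \<open>A second prime factor of \<open>m\<close> would supply another 3, so 9 would
    divide \<open>3 * (q ^ k * m)\<close>, although 3 divides neither \<open>q ^ k\<close> nor
    \<open>m\<close>.\<close>
  have "l = 1"
  proof (rule ccontr)
    assume "l \<noteq> 1"
    then obtain p' where p': "prime p'" "p' dvd l" using prime_factor_nat by blast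
    obtain l' where l': "l = p' * l'" "coprime p' l'"
      by (rule squarefree_prime_dvdE[OF l(3) p'])
    have "3 dvd 1 + p' + p'\<^sup>2" using residue_m[of p'] p' l three_dvd_cyclotomic3 by auto
    then have "3 dvd sigma (l\<^sup>2)"
      by (simp only: l'(1) sigma_square_prime_mult[OF p'(1) l'(2)] dvd_mult2)
    moreover have "3 dvd 1 + p + p\<^sup>2" using residue_m p three_dvd_cyclotomic3 by blast
    ultimately have "3 * 3 dvd (1 + p + p\<^sup>2) * sigma (l\<^sup>2)" by (rule mult_dvd_mono[rotated])
    then have "3 * 3 dvd 3 * (q ^ k * m)" using eqp by (metis dvd_mult)
    then have "3 dvd q ^ k * m" by (simp only: nat_mult_dvd_cancel_disj) simp
    then have "3 dvd m" using q3 prime_dvd_mult_iff[of "3::nat"] by simp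
    then show False using m(2) by (simp add: coprime_absorb_left)
  qed
  then have eq1: "13 * (1 + p + p\<^sup>2) = 3 * (q ^ k * p)" using eqp l by simp
  \<comment> \<open>Since \<open>1 + p + p\<^sup>2\<close> is 1 modulo \<open>p\<close>, the
    equation \<open>eq1\<close> forces \<open>p\<close> to divide 13.\<close>
  have "coprime p (Suc (p * (1 + p)))"
    by (rule coprime_divisors[OF _ dvd_refl coprime_Suc_right_nat]) simp
  then have "coprime p (1 + p + p\<^sup>2)"
    by (simp add: algebra_simps power2_eq_square)
  moreover have "p dvd 13 * (1 + p + p\<^sup>2)" using eq1 by simp
  ultimately have "p dvd 13" by (simp only: coprime_dvd_mult_left_iff)
  moreover have "prime (13 :: nat)" by simp
  ultimately have "p = 13" using p(1) by (simp add: primes_dvd_imp_eq)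
  then show ?thesis using eq1 l m \<open>l = 1\<close> by simp
qed

section \<open>Reduction of \<open>J = 1\<close> to this equation\<close>

theorem theorem3:
  fixes N q k n H I J :: nat
  assumes "odd N" and "perfect N" and "eulerian_form N q k n"
    and "H = gcd (n\<^sup>2) (sigma (n\<^sup>2))"
    and "I = gcd n (sigma (n\<^sup>2))"
    and "J = H div I"
    and "squarefree (sigma (q ^ k) div 2)"
  shows "J \<noteq> 1"
proof
  assume "J = 1"
  have q: "prime q" "q mod 4 = 1" and k: "k > 0" and n: "n > 0" and cop: "coprime q n"
    and N: "N = q ^ k * n\<^sup>2"
    using assms(3) by (auto simp: eulerian_form_def cong_def)
  define S where "S = sigma (q ^ k) div 2"
  have S: "sigma (q ^ k) = 2 * S"
    using eulerian_form_even_sigma[OF assms(3)] by (simp add: S_def)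
  have copS: "coprime (q ^ k) S"
    using coprime_sigma_prime_power[OF q(1), of k] S by simp
  have "sigma (q ^ k) * sigma (n\<^sup>2) = 2 * (q ^ k * n\<^sup>2)"
    using assms(2) N cop by (simp add: perfect_def sigma_mult_coprime)
  then have SS: "S * sigma (n\<^sup>2) = q ^ k * n\<^sup>2" using S by simp
  then have "q ^ k dvd sigma (n\<^sup>2)"
    using copS by (metis coprime_dvd_mult_right_iff dvd_triv_left)
  then obtain m where m: "sigma (n\<^sup>2) = q ^ k * m" ..
  have "q > 0" using q(1) by (rule prime_gt_0_nat)
  then have nm: "n\<^sup>2 = S * m" using SS m by simp
  \<comment> \<open>The two arguments are \<open>n\<^sup>2\<close> and
    \<open>sigma (n\<^sup>2)\<close>, so this computes \<open>H\<close>.\<close>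
  have "gcd (m * S) (m * q ^ k) = m"
    using copS by (simp only: gcd_mult_distrib_nat[symmetric] coprime_iff_gcd_eq_1 gcd.commute[of S] mult_1_right)
  then have "H = m"
    by (simp only: assms(4) m) (simp only: nm mult.commute)
  have "I dvd H" using gcd_dvd_gcd_square assms(4,5) by simp
  then have "H = I" using \<open>J = 1\<close> assms(6) by (metis dvd_div_mult_self mult_1)
  then have "m dvd n" using \<open>H = m\<close> assms(5) by simp
  then obtain t where t: "n = m * t" ..
  \<comment> \<open>Cancel \<open>m\<close> in \<open>(m * t)\<^sup>2 = S * m\<close>;
    squarefreeness of \<open>S\<close> then leaves only \<open>t = 1\<close>.\<close>
  have "S = t\<^sup>2 * m" using nm t n by (auto simp: power2_eq_square ac_simps)
  then have "t\<^sup>2 dvd S" by simp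
  then have "t = 1" using assms(7) by (auto simp: S_def squarefree_def)
  then have "m = n" "S = n" using t \<open>S = t\<^sup>2 * m\<close> by simp_all
  then have "n = 39 \<and> q ^ k = 61"
    using sigma_square_eq_prime_power_mult[of n q k] assms(7) q k m S_def by simp
  \<comment> \<open>With \<open>S = n = 39\<close> the value would have to be 78.\<close>
  moreover have "sigma 61 = 62"
    using sigma_prime_power[of 61 1] by simp
  ultimately show False using S \<open>S = n\<close> by simp
qed

end
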